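(* Let $F\in\mathrm{Exp}(\mathbb C^n,\mathbb C^m)$, with $1\le m\le n$. Then $F$ has closed spectra if and only if $\dim_H\mathcal Z_F\le n-m$, where $\dim_H$ denotes Hausdorff dimension.
   Context: An exponential sum is a finite non-trivial $\mathbb C$-linear combination of exponentials $e^{i\langle z,\lambda\rangle}$, $\lambda\in\mathbb R^n$, where $\langle z,w\rangle=\sum_j z_j\overline{w_j}$; it is written $f(z)=\sum_{\lambda\in\mathrm{Sp} f}a(\lambda,f)e^{i\langle z,\lambda\rangle}$ with $\mathrm{Sp} f$ finite and $a(\lambda,f)\neq0$ for $\lambda\in\mathrm{Sp} f$. $\mathrm{Exp}(\mathbb C^n,\mathbb C^m)$ is the set of mappings $F=(f_1,\dots,f_m):\mathbb C^n\to\mathbb C^m$ all of whose components are exponential sums. Let $\Gamma_\ell\subset i\mathbb R^n$ be the convex hull of $-i\,\mathrm{Sp} f_\ell$, and $\Gamma_F=\sum_{\ell=1}^m\Gamma_\ell$ (Minkowski sum). Every face $\Delta$ of $\Gamma_F$ ($\Gamma_F$ itself included) has a unique representation $\Delta=\sum_{\ell=1}^m\Delta_\ell$ with $\Delta_\ell$ a face of $\Gamma_\ell$. $F$ has closed spectra if for every face $\Delta=\sum_\ell\Delta_\ell$ of $\Gamma_F$ with $\dim\Delta<m$ there is $\ell\in\{1,\ldots,m\}$ such that $\Delta_\ell$ is a single point. Let $h_{\Gamma_\ell}(z)=\sup_{v\in\Gamma_\ell}\operatorname{Re}\langle z,v\rangle$ and, for $u\in i\mathbb R^n$, $H_{\Gamma_\ell}(u)=\{z\in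 i\mathbb R^n:\operatorname{Re}\langle z,u\rangle=h_{\Gamma_\ell}(u)\}$. Let $\Lambda_\ell=\partial\Gamma_\ell\cap(-i\,\mathrm{Sp} f_\ell)$, where $\partial$ is the topological boundary in $i\mathbb R^n$, and for $\lambda\in\Lambda_\ell$ let $K_{\lambda,\Gamma_\ell}=\{z\in i\mathbb R^n:\{\lambda\}=\Gamma_\ell\cap H_{\Gamma_\ell}(z)\}$ (possibly empty). Finally $\mathcal Z_\ell=i\mathbb R^n\setminus\bigcup_{\lambda\in\Lambda_\ell}K_{\lambda,\Gamma_\ell}$ and $\mathcal Z_F=\bigcap_{\ell=1}^m\mathcal Z_\ell$ (a subset of $i\mathbb R^n\cong\mathbb R^n$). *)

theory Defs
  imports "HOL-Analysis.Analysis"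
begin

section \<open>Exponential sums\<close>

definition herm :: "complex ^ 'n \<Rightarrow> complex ^ 'n \<Rightarrow> complex" where
  "herm z w = (\<Sum>j\<in>UNIV. z $ j * cnj (w $ j))"

definition cvec :: "real ^ 'n \<Rightarrow> complex ^ 'n" where
  "cvec x = (\<chi> j. complex_of_real (x $ j))"

text \<open>A frequency \<open>\<omega>\<close> lies in the spectrum iff its coefficient \<open>a \<omega>\<close> is nonzero.  The spectrum is
  required to be nonempty, since an exponential sum is a non-trivial combination.\<close>

definition exp_sum_rep :: "(complex ^ 'n \<Rightarrow> complex) \<Rightarrow> (real ^ 'n \<Rightarrow> complex) \<Rightarrow> bool" where
  "exp_sum_rep f a \<longleftrightarrow>
     finite {\<omega>. a \<omega> \<noteq> 0} \<and> {\<omega>. a \<omega> \<noteq> 0} \<noteq> {} \<and>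
     (\<forall>z. f z = (\<Sum>\<omega> | a \<omega> \<noteq> 0. a \<omega> * exp (\<i> * herm z (cvec \<omega>))))"

definition exp_sum :: "(complex ^ 'n \<Rightarrow> complex) \<Rightarrow> bool" where
  "exp_sum f \<longleftrightarrow> (\<exists>a. exp_sum_rep f a)"

definition exp_coeff :: "(complex ^ 'n \<Rightarrow> complex) \<Rightarrow> real ^ 'n \<Rightarrow> complex" where
  "exp_coeff f = (THE a. exp_sum_rep f a)"

definition spectrum :: "(complex ^ 'n \<Rightarrow> complex) \<Rightarrow> (real ^ 'n) set" where
  "spectrum f = {\<omega>. exp_coeff f \<omega> \<noteq> 0}"

definition component :: "(complex ^ 'n \<Rightarrow> complex ^ 'm) \<Rightarrow> 'm \<Rightarrow> complex ^ 'n \<Rightarrow> complex" where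
  "component F l = (\<lambda>z. F z $ l)"

definition Exp_maps :: "(complex ^ 'n \<Rightarrow> complex ^ 'm) set" where
  "Exp_maps = {F. \<forall>l. exp_sum (component F l)}"

text \<open>The exponentials are linearly independent, so the definite description in \<open>exp_coeff\<close> is
  meaningful.\<close>

lemma exponentials_independent:
  fixes c :: "real ^ 'n \<Rightarrow> complex"
  assumes "finite S" "\<And>z. (\<Sum>\<omega>\<in>S. c \<omega> * exp (\<i> * herm z (cvec \<omega>))) = 0" "\<omega> \<in> S"
  shows "c \<omega> = 0"
  using assms
proof (induction S arbitrary: c \<omega> rule: finite_induct)
  case empty
  then show ?case by simp
next
  case (insert \<mu> S)
  define E where "E = (\<lambda>\<omega> (z::complex ^ 'n). exp (\<i> * herm z (cvec \<omega>)))"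
  have E_add: "E \<omega> (z + w) = E \<omega> z * E \<omega> w" for \<omega> z w
    by (simp add: E_def herm_def distrib_right sum.distrib distrib_left exp_add)
  have zero: "(\<Sum>\<omega>\<in>insert \<mu> S. c \<omega> * E \<omega> z) = 0" for z
    using insert.prems(1) by (simp add: E_def)
  have cS: "c \<nu> = 0" if "\<nu> \<in> S" for \<nu>
  proof -
    from that insert.hyps obtain j where j: "\<nu> $ j \<noteq> \<mu> $ j" by (metis vec_eq_iff)
    define w :: "complex ^ 'n" where "w = axis j (- \<i>)"
    have E_w: "E \<omega> w = complex_of_real (exp (\<omega> $ j))" for \<omega>
    proof -
      have "herm w (cvec \<omega>) = (\<Sum>i\<in>UNIV. if i = j then - \<i> * complex_of_real (\<omega> $ j) else 0)"
        unfolding herm_def by (rule sum.cong) (auto simp: w_def axis_def cvec_def)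
      then show ?thesis by (simp add: E_def exp_of_real mult.assoc[symmetric])
    qed
    have neq: "E \<nu> w \<noteq> E \<mu> w" using j by (simp add: E_w)
    have "(\<Sum>\<omega>\<in>S. c \<omega> * (E \<omega> w - E \<mu> w) * E \<omega> z) = 0" for z
    proof -
      have "(\<Sum>\<omega>\<in>insert \<mu> S. c \<omega> * (E \<omega> w - E \<mu> w) * E \<omega> z)
          = (\<Sum>\<omega>\<in>insert \<mu> S. c \<omega> * E \<omega> (z + w)) - E \<mu> w * (\<Sum>\<omega>\<in>insert \<mu> S. c \<omega> * E \<omega> z)"
        unfolding sum_distrib_left sum_subtractf[symmetric]
        by (rule sum.cong) (simp_all add: E_add algebra_simps)
      also have "\<dots> = 0" by (simp only: zero) simp
      finally show ?thesis using insert.hyps by simp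
    qed
    with insert.IH[of "\<lambda>\<omega>. c \<omega> * (E \<omega> w - E \<mu> w)" \<nu>] that
    have "c \<nu> * (E \<nu> w - E \<mu> w) = 0" by (simp add: E_def)
    with neq show ?thesis by simp
  qed
  have "c \<mu> * E \<mu> 0 = 0" using zero[of 0] insert.hyps cS by simp
  then have "c \<mu> = 0" by (simp add: E_def)
  with cS insert.prems show ?case by auto
qed

lemma exp_sum_rep_unique:
  assumes a: "exp_sum_rep f a" and b: "exp_sum_rep f b"
  shows "a = b"
proof
  fix \<omega>
  let ?S = "{\<omega>. a \<omega> \<noteq> 0} \<union> {\<omega>. b \<omega> \<noteq> 0}"
  have fin: "finite ?S" using a b by (simp add: exp_sum_rep_def)
  have fa: "f z = (\<Sum>\<omega>\<in>?S. a \<omega> * exp (\<i> * herm z (cvec \<omega>)))" for z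
    using a fin unfolding exp_sum_rep_def by (auto intro!: sum.mono_neutral_left)
  have fb: "f z = (\<Sum>\<omega>\<in>?S. b \<omega> * exp (\<i> * herm z (cvec \<omega>)))" for z
    using b fin unfolding exp_sum_rep_def by (auto intro!: sum.mono_neutral_left)
  have "(\<Sum>\<omega>\<in>?S. (a \<omega> - b \<omega>) * exp (\<i> * herm z (cvec \<omega>))) = 0" for z
    using fa[of z] fb[of z] by (simp add: left_diff_distrib sum_subtractf)
  from exponentials_independent[OF fin this] have "\<omega> \<in> ?S \<Longrightarrow> a \<omega> - b \<omega> = 0" .
  then show "a \<omega> = b \<omega>" by (cases "\<omega> \<in> ?S") auto
qed

lemma exp_sum_rep_exp_coeff: "exp_sum f \<Longrightarrow> exp_sum_rep f (exp_coeff f)"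
  unfolding exp_sum_def exp_coeff_def by (metis theI exp_sum_rep_unique)


section \<open>Newton polytopes and closed spectra\<close>

text \<open>The real subspace \<open>i\<real>\<^sup>n\<close> of \<open>\<complex>\<^sup>n\<close>.\<close>

definition imag_space :: "(complex ^ 'n) set" where
  "imag_space = {z. \<forall>j. Re (z $ j) = 0}"

definition rotated_spectrum :: "(complex ^ 'n \<Rightarrow> complex) \<Rightarrow> (complex ^ 'n) set" where
  "rotated_spectrum f = (\<lambda>\<omega>. (- \<i>) *s cvec \<omega>) ` spectrum f"

definition newton_polytope :: "(complex ^ 'n \<Rightarrow> complex) \<Rightarrow> (complex ^ 'n) set" where
  "newton_polytope f = convex hull (rotated_spectrum f)"

text \<open>The sum over the components is the Minkowski sum of sets.\<close>

definition newton_polytope_sum :: "(complex ^ 'n \<Rightarrow> complex ^ 'm) \<Rightarrow> (complex ^ 'n) set" where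
  "newton_polytope_sum F = (\<Sum>l\<in>UNIV. newton_polytope (component F l))"

text \<open>The library's \<open>face_of\<close> admits the empty face, which is excluded here.  The representation of
  \<open>\<Delta>\<close> as a sum of faces exists and is unique, so it does not matter whether one quantifies
  universally or existentially over it.\<close>

definition closed_spectra :: "(complex ^ 'n \<Rightarrow> complex ^ 'm) \<Rightarrow> bool" where
  "closed_spectra F \<longleftrightarrow>
     (\<forall>\<Delta> D. \<Delta> face_of newton_polytope_sum F \<longrightarrow> \<Delta> \<noteq> {} \<longrightarrow>
        (\<forall>l. D l face_of newton_polytope (component F l)) \<longrightarrow> \<Delta> = (\<Sum>l\<in>UNIV. D l) \<longrightarrow>
        aff_dim \<Delta> < int CARD('m) \<longrightarrow>
        (\<exists>l v. D l = {v}))"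


section \<open>The exceptional set\<close>

definition support_fun :: "(complex ^ 'n) set \<Rightarrow> complex ^ 'n \<Rightarrow> real" where
  "support_fun \<Gamma> z = (SUP v\<in>\<Gamma>. Re (herm z v))"

definition support_plane :: "(complex ^ 'n) set \<Rightarrow> complex ^ 'n \<Rightarrow> (complex ^ 'n) set" where
  "support_plane \<Gamma> u = {z \<in> imag_space. Re (herm z u) = support_fun \<Gamma> u}"

text \<open>The boundary is taken relative to \<open>i\<real>\<^sup>n\<close>, not in \<open>\<complex>\<^sup>n\<close>.\<close>

definition boundary_spectrum :: "(complex ^ 'n \<Rightarrow> complex) \<Rightarrow> (complex ^ 'n) set" where
  "boundary_spectrum f =
     (top_of_set imag_space frontier_of newton_polytope f) \<inter> rotated_spectrum f"

definition dual_cone :: "complex ^ 'n \<Rightarrow> (complex ^ 'n) set \<Rightarrow> (complex ^ 'n) set" where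
  "dual_cone \<omega> \<Gamma> = {z \<in> imag_space. {\<omega>} = \<Gamma> \<inter> support_plane \<Gamma> z}"

definition exceptional_set :: "(complex ^ 'n \<Rightarrow> complex) \<Rightarrow> (complex ^ 'n) set" where
  "exceptional_set f =
     imag_space - (\<Union>\<omega>\<in>boundary_spectrum f. dual_cone \<omega> (newton_polytope f))"

definition exceptional_set_map :: "(complex ^ 'n \<Rightarrow> complex ^ 'm) \<Rightarrow> (complex ^ 'n) set" where
  "exceptional_set_map F = (\<Inter>l. exceptional_set (component F l))"


section \<open>Hausdorff dimension\<close>

text \<open>The \<open>s\<close>-th power of the diameter of a bounded set, with the usual conventions that it is \<open>0\<close>
  for the empty set and \<open>1\<close> for nonempty sets if \<open>s = 0\<close> (whereas \<open>0 powr 0 = 0\<close>).\<close>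

definition diameter_power :: "real \<Rightarrow> 'a::metric_space set \<Rightarrow> ennreal" where
  "diameter_power s U = (if U = {} then 0 else if s = 0 then 1 else ennreal (diameter U powr s))"

definition hausdorff_premeasure :: "real \<Rightarrow> real \<Rightarrow> 'a::metric_space set \<Rightarrow> ennreal" where
  "hausdorff_premeasure s \<delta> A =
     Inf {(\<Sum>i. diameter_power s (U i)) | U :: nat \<Rightarrow> 'a set.
            A \<subseteq> (\<Union>i. U i) \<and> (\<forall>i. bounded (U i) \<and> diameter (U i) \<le> \<delta>)}"

definition hausdorff_measure :: "real \<Rightarrow> 'a::metric_space set \<Rightarrow> ennreal" where
  "hausdorff_measure s A = (SUP \<delta>\<in>{0<..}. hausdorff_premeasure s \<delta> A)"

definition hausdorff_dim :: "'a::metric_space set \<Rightarrow> ennreal" where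
  "hausdorff_dim A = Inf {ennreal s | s. 0 \<le> s \<and> hausdorff_measure s A = 0}"

end

(* A vector u lies in Z_F iff no Gamma_l attains its
   maximum in direction u at a single point, and the maximising face of Gamma_F in direction u is
   the sum of those of the Gamma_l.  With closed spectra this face has dimension at least m, and u
   is orthogonal to it, so Z_F is contained in finitely many subspaces of dimension at most n - m.
   Conversely, if a face of dimension d < m has no summand that is a point, its closed normal cone
   is contained in Z_F, and that cone contains a ball of an (n - d)-dimensional subspace. *)
theory Submission
  imports Defs
begin

section \<open>Hausdorff null sets\<close>

text \<open>\<open>hausdorff_dim\<close> is an infimum over exponents of measure zero, so no
  dimension is ever computed: the upper bound asks for null sets at every \<open>s > n - m\<close>,
  the lower bound refutes nullity at every \<open>s < dim S\<close> for a subspace \<open>S\<close>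
  of dimension above \<open>n - m\<close>. The second must face covers by arbitrary sets and is
  settled by comparison with Lebesgue measure.

  In the converse, one normal \<open>u\<close> of the bad face has to yield a whole ball of
  directions. A free perturbation of \<open>u\<close> may shrink the face to a vertex; a
  perturbation orthogonal to the face keeps its points tied. The face in the new direction then
  contains the bad one, and comparing summands shows that none of them has become a point.\<close>

lemma hausdorff_measure_eq_0_iff:
  "hausdorff_measure s A = 0 \<longleftrightarrow>
    (\<forall>\<delta>>0. \<forall>e>0. \<exists>U. A \<subseteq> (\<Union>i. U i) \<and> (\<forall>i. bounded (U i) \<and> diameter (U i) \<le> \<delta>) \<and>
       (\<Sum>i. diameter_power s (U i)) < e)"
proof -
  have "hausdorff_measure s A = 0 \<longleftrightarrow> (\<forall>\<delta>>0. hausdorff_premeasure s \<delta> A = 0)"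
    unfolding hausdorff_measure_def bot_ennreal[symmetric] SUP_bot_conv by auto
  also have "\<dots> \<longleftrightarrow> (\<forall>\<delta>>0. \<forall>e>0. hausdorff_premeasure s \<delta> A < e)"
    by (metis gr_zeroI less_irrefl)
  moreover have "hausdorff_premeasure s \<delta> A < e \<longleftrightarrow>
      (\<exists>U. A \<subseteq> (\<Union>i. U i) \<and> (\<forall>i. bounded (U i) \<and> diameter (U i) \<le> \<delta>) \<and>
         (\<Sum>i. diameter_power s (U i)) < e)" for \<delta> e
    unfolding hausdorff_premeasure_def Inf_less_iff by blast
  ultimately show ?thesis by simp
qed

lemma hausdorff_measure_0_mono:
  assumes "hausdorff_measure s B = 0" "A \<subseteq> B"
  shows "hausdorff_measure s A = 0"
  unfolding hausdorff_measure_eq_0_iff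
proof (intro allI impI)
  fix \<delta> :: real and e :: ennreal
  assume "0 < \<delta>" "0 < e"
  obtain U where "B \<subseteq> (\<Union>i. U i)" "\<forall>i. bounded (U i) \<and> diameter (U i) \<le> \<delta>"
      "(\<Sum>i. diameter_power s (U i)) < e"
    using assms(1)[unfolded hausdorff_measure_eq_0_iff, rule_format, OF \<open>0 < \<delta>\<close> \<open>0 < e\<close>] by blast
  with assms(2) show "\<exists>U. A \<subseteq> (\<Union>i. U i) \<and> (\<forall>i. bounded (U i) \<and> diameter (U i) \<le> \<delta>) \<and>
      (\<Sum>i. diameter_power s (U i)) < e"
    by (intro exI[of _ U]) auto
qed

lemma hausdorff_measure_0_UN:
  fixes A :: "nat \<Rightarrow> 'a::metric_space set"
  assumes "\<And>n. hausdorff_measure s (A n) = 0"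
  shows "hausdorff_measure s (\<Union>n. A n) = 0"
  unfolding hausdorff_measure_eq_0_iff
proof (intro allI impI)
  fix \<delta> :: real and e :: ennreal
  assume "0 < \<delta>" "0 < e"
  \<comment> \<open>\<open>e\<close> may be infinite; a positive real below it lets the errors
    \<open>r * (1/2) ^ Suc n\<close> add up to \<open>r\<close> by the geometric series.\<close>
  obtain r :: real where r: "0 < r" "ennreal r < e"
  proof -
    obtain x where "0 < x" "x < e" using dense[OF \<open>0 < e\<close>] by blast
    then show ?thesis using that by (cases x) auto
  qed
  have "\<exists>U. A n \<subseteq> (\<Union>i. U i) \<and> (\<forall>i. bounded (U i) \<and> diameter (U i) \<le> \<delta>) \<and>
       (\<Sum>i. diameter_power s (U i)) < ennreal (r * (1/2) ^ Suc n)" for n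
    using assms[of n] \<open>0 < \<delta>\<close> r(1) unfolding hausdorff_measure_eq_0_iff by simp
  then obtain U where U: "\<And>n. A n \<subseteq> (\<Union>i. U n i)"
      "\<And>n i. bounded (U n i)" "\<And>n i. diameter (U n i) \<le> \<delta>"
      "\<And>n. (\<Sum>i. diameter_power s (U n i)) < ennreal (r * (1/2) ^ Suc n)"
    by metis
  define V where "V = (\<lambda>k. (\<lambda>(n, i). U n i) (prod_decode k))"
  have VU: "U n i = V (prod_encode (n, i))" for n i by (simp add: V_def)
  have "(\<Sum>k. diameter_power s (V k)) = (\<Sum>n. \<Sum>i. diameter_power s (U n i))"
    unfolding V_def
    using suminf_ennreal_2dimen[of "\<lambda>n. \<Sum>i. diameter_power s (U n i)"
        "\<lambda>p. diameter_power s ((\<lambda>(n, i). U n i) p)"] by simp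
  also have "\<dots> \<le> (\<Sum>n. ennreal (r * (1/2) ^ Suc n))"
    using U(4) by (intro suminf_le) (auto intro: less_imp_le)
  also have "\<dots> = ennreal r"
    using sums_mult[OF power_half_series, of r] r(1) by (intro suminf_ennreal_eq) auto
  finally have "(\<Sum>k. diameter_power s (V k)) < e" using r(2) by simp
  moreover have "(\<Union>n. A n) \<subseteq> (\<Union>k. V k)"
    using U(1) unfolding VU by blast
  moreover have "bounded (V k) \<and> diameter (V k) \<le> \<delta>" for k
    using U(2,3) by (simp add: V_def split: prod.split)
  ultimately show "\<exists>U. (\<Union>n. A n) \<subseteq> (\<Union>i. U i) \<and> (\<forall>i. bounded (U i) \<and> diameter (U i) \<le> \<delta>) \<and>
       (\<Sum>i. diameter_power s (U i)) < e" by - (intro exI[of _ V] conjI allI; blast)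
qed

text \<open>The enumeration \<open>from_nat_into\<close> needs a nonempty family. The empty one is
  covered by empty sets, which cost 0 even at \<open>s = 0\<close> by the convention in
  \<open>diameter_power\<close>.\<close>

lemma hausdorff_measure_0_Union_finite:
  fixes \<A> :: "'a::metric_space set set"
  assumes "finite \<A>" "\<And>A. A \<in> \<A> \<Longrightarrow> hausdorff_measure s A = 0"
  shows "hausdorff_measure s (\<Union>\<A>) = 0"
proof (cases "\<A> = {}")
  case True
  have "\<exists>U :: nat \<Rightarrow> 'a set. (\<forall>i. bounded (U i) \<and> diameter (U i) \<le> \<delta>) \<and> (\<Sum>i. diameter_power s (U i)) < e"
    if "0 < \<delta>" "0 < e" for \<delta> and e :: ennreal
    using that by (intro exI[of _ "\<lambda>_. {}"]) (simp add: diameter_power_def)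
  then show ?thesis using True by (simp add: hausdorff_measure_eq_0_iff)
next
  case False
  then have r: "range (from_nat_into \<A>) = \<A>"
    using assms(1) by (simp add: countable_finite)
  then show ?thesis
    using hausdorff_measure_0_UN[of s "from_nat_into \<A>"] assms(2) by (metis rangeI)
qed

text \<open>Padding by empty sets, which cost nothing, turns a finite cover into a sequence. The
  index type is left free so that grid cells can be indexed by functions from a basis to the
  integers.\<close>

lemma hausdorff_measure_0_finite_covers:
  assumes "\<And>\<delta> e. 0 < \<delta> \<Longrightarrow> 0 < e \<Longrightarrow> \<exists>(I :: 'i set) U. finite I \<and> A \<subseteq> (\<Union>i\<in>I. U i) \<and>
     (\<forall>i\<in>I. bounded (U i) \<and> diameter (U i) \<le> \<delta>) \<and> (\<Sum>i\<in>I. diameter_power s (U i)) < e"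
  shows "hausdorff_measure s A = 0"
  unfolding hausdorff_measure_eq_0_iff
proof (intro allI impI)
  fix \<delta> :: real and e :: ennreal
  assume "0 < \<delta>" "0 < e"
  then obtain I :: "'i set" and U where I: "finite I" "A \<subseteq> (\<Union>i\<in>I. U i)"
     "\<forall>i\<in>I. bounded (U i) \<and> diameter (U i) \<le> \<delta>" "(\<Sum>i\<in>I. diameter_power s (U i)) < e"
    using assms by metis
  obtain h where h: "bij_betw h {0..<card I} I"
    using ex_bij_betw_nat_finite[OF I(1)] by blast
  define V where "V = (\<lambda>k. if k < card I then U (h k) else {})"
  have hI: "h k \<in> I" if "k < card I" for k
    using h that by (auto simp: bij_betw_def)
  have "(\<Sum>k. diameter_power s (V k)) = (\<Sum>k\<in>{0..<card I}. diameter_power s (V k))"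
    by (intro suminf_finite) (auto simp: V_def diameter_power_def)
  also have "\<dots> = (\<Sum>k\<in>{0..<card I}. diameter_power s (U (h k)))"
    by (intro sum.cong) (auto simp: V_def)
  also have "\<dots> = (\<Sum>i\<in>I. diameter_power s (U i))"
    by (rule sum.reindex_bij_betw[OF h])
  finally have "(\<Sum>k. diameter_power s (V k)) < e" using I(4) by simp
  moreover have "A \<subseteq> (\<Union>k. V k)"
  proof
    fix x assume "x \<in> A"
    then obtain i where i: "i \<in> I" "x \<in> U i" using I(2) by auto
    with h obtain k where "k < card I" "h k = i"
      by (metis atLeastLessThan_iff bij_betw_iff_bijections)
    with i have "x \<in> V k" by (simp add: V_def)
    then show "x \<in> (\<Union>k. V k)" by blast
  qed
  moreover have "bounded (V k) \<and> diameter (V k) \<le> \<delta>" for k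
    using I(3) hI \<open>0 < \<delta>\<close> by (simp add: V_def)
  ultimately show "\<exists>U. A \<subseteq> (\<Union>i. U i) \<and> (\<forall>i. bounded (U i) \<and> diameter (U i) \<le> \<delta>) \<and>
       (\<Sum>i. diameter_power s (U i)) < e" by blast
qed

lemma hausdorff_dim_leI:
  assumes "0 \<le> d" "\<And>s. d < s \<Longrightarrow> hausdorff_measure s A = 0"
  shows "hausdorff_dim A \<le> ennreal d"
proof (rule ennreal_le_epsilon)
  fix e :: real assume "0 < e"
  then have "hausdorff_measure (d + e) A = 0" using assms by simp
  then have "hausdorff_dim A \<le> ennreal (d + e)"
    unfolding hausdorff_dim_def using assms(1) \<open>0 < e\<close> \<open>hausdorff_measure (d + e) A = 0\<close>
    by (intro Inf_lower CollectI exI[of _ "d + e"]) simp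
  then show "hausdorff_dim A \<le> ennreal d + ennreal e"
    using assms \<open>0 < e\<close> by (simp add: ennreal_plus)
qed

lemma hausdorff_dim_lessE:
  assumes "hausdorff_dim A < ennreal d"
  obtains s where "0 \<le> s" "s < d" "hausdorff_measure s A = 0"
proof -
  obtain s where s: "ennreal s < ennreal d" "0 \<le> s" "hausdorff_measure s A = 0"
    using assms unfolding hausdorff_dim_def Inf_less_iff by blast
  then have "s < d" by (simp add: ennreal_less_iff)
  with s that show ?thesis by blast
qed

section \<open>Hausdorff measure and subspaces\<close>

text \<open>Orthonormal expansion and the triangle inequality. The loss is a factor depending only
  on the dimension, harmless both for the diameter of grid cells and for fitting a box into a
  ball.\<close>

lemma norm_diff_le_sum_orthonormal:
  fixes x y :: "'a::euclidean_space"
  assumes "pairwise orthogonal B" "\<And>b. b \<in> B \<Longrightarrow> norm b = 1" "finite B" "x \<in> span B" "y \<in> span B"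
  shows "norm (x - y) \<le> (\<Sum>b\<in>B. \<bar>x \<bullet> b - y \<bullet> b\<bar>)"
proof -
  have "x - y = (\<Sum>b\<in>B. ((x - y) \<bullet> b) *\<^sub>R b)"
    using orthonormal_basis_expand[OF assms(1,2) _ assms(3), of "x - y"] assms(4,5)
    by (simp add: span_diff)
  also have "norm \<dots> \<le> (\<Sum>b\<in>B. norm (((x - y) \<bullet> b) *\<^sub>R b))" by (rule norm_sum)
  also have "\<dots> = (\<Sum>b\<in>B. \<bar>x \<bullet> b - y \<bullet> b\<bar>)"
    using assms(2) by (simp add: inner_diff_left)
  finally show ?thesis .
qed

text \<open>Grid counting: with \<open>k = dim S\<close>, at most
  \<open>((2 * R + 1) * N) ^ k\<close> cells of side \<open>1 / N\<close> are needed, each of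
  diameter at most \<open>k / N\<close>. Their total cost is at most a constant times
  \<open>N powr (k - s)\<close>, which tends to 0 because \<open>k < s\<close>.\<close>

lemma hausdorff_measure_subspace_ball_0:
  fixes S :: "'a::euclidean_space set" and R :: nat
  assumes "subspace S" "real (dim S) < s"
  shows "hausdorff_measure s (S \<inter> cball 0 (real R)) = 0"
proof (rule hausdorff_measure_0_finite_covers[where 'i = "'a \<Rightarrow> int"])
  fix \<delta> :: real and e :: ennreal
  assume "0 < \<delta>" "0 < e"
  obtain B where B: "pairwise orthogonal B" "\<And>b. b \<in> B \<Longrightarrow> norm b = 1" "independent B"
    "card B = dim S" "span B = S"
    using orthonormal_basis_subspace[OF assms(1)] by metis
  define k where "k = dim S"
  have ks: "real k < s" "0 < s" using assms(2) by (auto simp: k_def)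
  have finB: "finite B" using B(3) by (rule independent_imp_finite)
  \<comment> \<open>The first factor is the bound on the number of cells divided by
    \<open>N ^ k\<close>; \<open>k powr s\<close> comes from the diameter bound
    \<open>k / N\<close>.\<close>
  define C where "C = real (2 * R + 1) ^ k * real k powr s"
  have "(\<lambda>N::nat. C * real N powr (real k - s)) \<longlonglongrightarrow> C * 0"
    using ks by (intro tendsto_mult_left tendsto_neg_powr filterlim_real_sequentially) auto
  then have "(\<lambda>N::nat. ennreal (C * real N powr (real k - s))) \<longlonglongrightarrow> ennreal 0"
    by (intro tendsto_ennrealI) simp
  then have "eventually (\<lambda>N. ennreal (C * real N powr (real k - s)) < e) sequentially"
    using \<open>0 < e\<close> by (intro order_tendstoD) auto
  moreover have "(\<lambda>N::nat. real k / real N) \<longlonglongrightarrow> 0" by (rule lim_const_over_n)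
  then have "eventually (\<lambda>N::nat. real k / real N < \<delta>) sequentially"
    using \<open>0 < \<delta>\<close> by (rule order_tendstoD)
  ultimately have "eventually (\<lambda>N::nat. ennreal (C * real N powr (real k - s)) < e \<and>
      real k / real N < \<delta> \<and> 1 \<le> N) sequentially"
    using eventually_ge_at_top[of "1::nat"] by eventually_elim auto
  then obtain N :: nat where N: "ennreal (C * real N powr (real k - s)) < e"
      "real k / real N < \<delta>" "1 \<le> N"
    using eventually_happens'[OF sequentially_bot] by blast
  \<comment> \<open>On the ball each coordinate lies between \<open>- R\<close> and
    \<open>R\<close>, so each floor takes one of \<open>2 * R * N + 1\<close> values.\<close>
  define I where "I = (B \<rightarrow>\<^sub>E {- int (R * N)..int (R * N)})"
  define U where "U = (\<lambda>g. {x \<in> S. \<forall>b\<in>B. \<lfloor>real N * (x \<bullet> b)\<rfloor> = (g b :: int)})"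
  have "finite I" unfolding I_def using finB by (intro finite_PiE) auto
  moreover have "S \<inter> cball 0 (real R) \<subseteq> (\<Union>i\<in>I. U i)"
  proof
    fix x assume x: "x \<in> S \<inter> cball 0 (real R)"
    define g where "g = restrict (\<lambda>b. \<lfloor>real N * (x \<bullet> b)\<rfloor>) B"
    have "- int (R * N) \<le> \<lfloor>real N * (x \<bullet> b)\<rfloor> \<and> \<lfloor>real N * (x \<bullet> b)\<rfloor> \<le> int (R * N)"
      if "b \<in> B" for b
    proof -
      have "\<bar>x \<bullet> b\<bar> \<le> real R"
        using Cauchy_Schwarz_ineq2[of x b] B(2)[OF that] x by simp
      then have "\<bar>real N * (x \<bullet> b)\<bar> \<le> real (R * N)"
        by (simp add: abs_mult mult.commute mult_left_mono)
      then have "- real (R * N) \<le> real N * (x \<bullet> b)" "real N * (x \<bullet> b) \<le> real (R * N)"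
        by linarith+
      then show ?thesis by (metis floor_le_iff le_floor_iff floor_mono floor_of_nat of_int_minus of_int_of_nat_eq)
    qed
    then have "g \<in> I" by (auto simp: g_def I_def)
    moreover have "x \<in> U g" using x by (auto simp: g_def U_def)
    ultimately show "x \<in> (\<Union>i\<in>I. U i)" by blast
  qed
  moreover have d: "dist x y \<le> real k / real N" if "x \<in> U g" "y \<in> U g" for x y g
  proof -
    have "\<bar>x \<bullet> b - y \<bullet> b\<bar> \<le> 1 / real N" if "b \<in> B" for b
    proof -
      have "\<lfloor>real N * (x \<bullet> b)\<rfloor> = \<lfloor>real N * (y \<bullet> b)\<rfloor>"
        using that \<open>x \<in> U g\<close> \<open>y \<in> U g\<close> by (simp add: U_def)
      then have "\<bar>real N * (x \<bullet> b) - real N * (y \<bullet> b)\<bar> \<le> 1" by linarith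
      then have "real N * \<bar>x \<bullet> b - y \<bullet> b\<bar> \<le> 1"
        by (simp add: right_diff_distrib[symmetric] abs_mult)
      then show ?thesis using N(3) by (simp add: field_simps)
    qed
    then have "(\<Sum>b\<in>B. \<bar>x \<bullet> b - y \<bullet> b\<bar>) \<le> (\<Sum>b\<in>B. 1 / real N)" by (rule sum_mono)
    also have "\<dots> = real k / real N" using B(4) by (simp add: k_def)
    finally show ?thesis
      using norm_diff_le_sum_orthonormal[OF B(1,2) finB, of x y] that B(5)
      by (simp add: U_def dist_norm)
  qed
  have diam: "diameter (U g) \<le> real k / real N" for g
    using d by (intro diameter_le) (auto simp: dist_norm)
  moreover have bdd: "bounded (U g)" for g
    unfolding bounded_two_points using d by blast
  moreover have "diameter (U g) \<le> \<delta>" for g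
    using diam[of g] N(2) by linarith
  moreover have "(\<Sum>i\<in>I. diameter_power s (U i)) < e"
  proof -
    \<comment> \<open>An empty cell costs 0, and the special value at \<open>s = 0\<close> cannot
      occur since \<open>k < s\<close>.\<close>
    have "diameter_power s (U i) \<le> ennreal ((real k / real N) powr s)" for i
      using ks diam[of i] bdd[of i]
      by (auto simp: diameter_power_def intro!: ennreal_leI powr_mono2 diameter_ge_0)
    then have "(\<Sum>i\<in>I. diameter_power s (U i)) \<le> (\<Sum>i\<in>I. ennreal ((real k / real N) powr s))"
      by (intro sum_mono)
    also have "\<dots> = ennreal (real (card I) * (real k / real N) powr s)"
      by (simp add: ennreal_mult ennreal_of_nat_eq_real_of_nat)
    also have "\<dots> \<le> ennreal (C * real N powr (real k - s))"
    proof (rule ennreal_leI)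
      have "real (card I) = real (2 * R * N + 1) ^ k"
        unfolding I_def using finB B(4) by (simp add: card_PiE k_def algebra_simps)
      also have "\<dots> \<le> (real (2 * R + 1) * real N) ^ k"
        using N(3) by (intro power_mono) (simp_all add: algebra_simps flip: of_nat_mult)
      finally have "real (card I) \<le> real (2 * R + 1) ^ k * real N powr real k"
        using N(3) by (simp add: power_mult_distrib powr_realpow)
      then have "real (card I) * (real k / real N) powr s
          \<le> (real (2 * R + 1) ^ k * real N powr real k) * (real k / real N) powr s"
        by (intro mult_right_mono) auto
      also have "\<dots> = C * real N powr (real k - s)"
        by (simp add: C_def powr_divide powr_diff)
      finally show "real (card I) * (real k / real N) powr s \<le> C * real N powr (real k - s)" .
    qed
    finally show ?thesis using N(1) by simp
  qed
  ultimately show "\<exists>(I :: ('a \<Rightarrow> int) set) U. finite I \<and> S \<inter> cball 0 (real R) \<subseteq> (\<Union>i\<in>I. U i) \<and>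
     (\<forall>i\<in>I. bounded (U i) \<and> diameter (U i) \<le> \<delta>) \<and> (\<Sum>i\<in>I. diameter_power s (U i)) < e"
    by - (rule exI[of _ I], rule exI[of _ U], simp)
qed

lemma hausdorff_measure_subspace_0:
  fixes S :: "'a::euclidean_space set"
  assumes "subspace S" "real (dim S) < s"
  shows "hausdorff_measure s S = 0"
proof -
  have "S \<subseteq> (\<Union>R::nat. S \<inter> cball 0 (real R))"
    by (auto simp: real_arch_simple)
  then show ?thesis
    by (rule hausdorff_measure_0_mono[OF hausdorff_measure_0_UN[OF hausdorff_measure_subspace_ball_0[OF assms]]])
qed

text \<open>After an isometry onto a coordinate subspace, thickening by a unit cube in the remaining
  coordinates turns a covering into one by boxes of the full space, whose Lebesgue measures are
  bounded by the powers of the diameters.\<close>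

lemma hausdorff_measure_neq_0:
  fixes S A :: "'a::euclidean_space set"
  assumes S: "subspace S" and s: "0 \<le> s" "s < real (dim S)"
    and c: "c \<in> S" "0 < r" and A: "S \<inter> cball c r \<subseteq> A"
  shows "hausdorff_measure s A \<noteq> 0"
proof
  assume null: "hausdorff_measure s A = 0"
  define k where "k = dim S"
  have "k \<le> card (Basis :: 'a set)" by (simp add: k_def dim_subset_UNIV)
  then obtain B :: "'a set" where B: "B \<subseteq> Basis" "card B = k"
    by (meson obtain_subset_with_card_n)
  have finB: "finite B" using B(1) finite_Basis finite_subset by blast
  have orth: "pairwise orthogonal B" "\<And>b. b \<in> B \<Longrightarrow> norm b = 1"
    using B(1) by (auto simp: pairwise_def orthogonal_def inner_Basis subset_iff)
  have "dim (span B) = k"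
    using B by (metis dim_eq_card_independent dim_span independent_Basis independent_mono)
  then have "dim S = dim (span B)" by (simp add: k_def)
  then obtain f g where g: "linear g" "g ` span B = S" "\<And>x. x \<in> span B \<Longrightarrow> norm (g x) = norm x"
    using isometries_subspaces[OF S subspace_span] by metis
  have gdist: "norm (g x - g y) = norm (x - y)" if "x \<in> span B" "y \<in> span B" for x y
    using g(3)[of "x - y"] that linear_diff[OF g(1)] by (simp add: span_diff)
  obtain q where q: "q \<in> span B" "g q = c" using c(1) g(2) by blast
  \<comment> \<open>The orthogonal projection onto the coordinate subspace \<open>span B\<close>;
    followed by \<open>g\<close> it maps the whole space into \<open>S\<close>.\<close>
  define p where "p = (\<lambda>y::'a. \<Sum>b\<in>B. (y \<bullet> b) *\<^sub>R b)"
  have p_span: "p y \<in> span B" for y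
    by (simp add: p_def span_base span_scale span_sum)
  have p_inner: "p y \<bullet> b = y \<bullet> b" if "b \<in> B" for y b
  proof -
    have "p y \<bullet> b = (\<Sum>a\<in>B. if a = b then y \<bullet> b else 0)"
      unfolding p_def inner_sum_left using that B(1)
      by (intro sum.cong) (auto simp: inner_Basis subset_iff)
    then show ?thesis using that finB by simp
  qed
  define box where "box = (\<lambda>(x::'a) \<rho>. cbox (\<Sum>b\<in>Basis. (if b \<in> B then x \<bullet> b - \<rho> else 0) *\<^sub>R b)
                                 (\<Sum>b\<in>Basis. (if b \<in> B then x \<bullet> b + \<rho> else 1) *\<^sub>R b))"
  have mem_box: "y \<in> box x \<rho> \<longleftrightarrow> (\<forall>b\<in>B. \<bar>y \<bullet> b - x \<bullet> b\<bar> \<le> \<rho>) \<and> (\<forall>b\<in>Basis - B. 0 \<le> y \<bullet> b \<and> y \<bullet> b \<le> 1)"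
    for x y \<rho>
  proof -
    have "y \<in> box x \<rho> \<longleftrightarrow> (\<forall>b\<in>Basis. if b \<in> B then \<bar>y \<bullet> b - x \<bullet> b\<bar> \<le> \<rho> else 0 \<le> y \<bullet> b \<and> y \<bullet> b \<le> 1)"
      unfolding box_def mem_box by (rule ball_cong) auto
    also have "\<dots> \<longleftrightarrow> (\<forall>b\<in>B. \<bar>y \<bullet> b - x \<bullet> b\<bar> \<le> \<rho>) \<and> (\<forall>b\<in>Basis - B. 0 \<le> y \<bullet> b \<and> y \<bullet> b \<le> 1)"
      using B(1) by auto
    finally show ?thesis .
  qed
  have vol: "emeasure lborel (box x \<rho>) = ennreal ((2 * \<rho>) ^ k)" if "0 \<le> \<rho>" for x \<rho>
  proof -
    have "emeasure lborel (box x \<rho>) = ennreal (\<Prod>b\<in>Basis. if b \<in> B then 2 * \<rho> else 1)"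
      unfolding box_def using that
      by (subst emeasure_lborel_cbox) (auto simp: inner_diff_left intro!: arg_cong[of _ _ ennreal] prod.cong)
    also have "(\<Prod>b\<in>Basis. if b \<in> B then 2 * \<rho> else 1) = (2 * \<rho>) ^ k"
      using B by (simp add: prod.If_cases Int_absorb1)
    finally show ?thesis .
  qed
  have box_sets: "box x \<rho> \<in> sets lborel" for x \<rho> by (simp add: box_def)
  \<comment> \<open>The \<open>k\<close> coordinate errors of size \<open>\<rho>\<close> must add up
    to at most \<open>r\<close>; \<open>k + 1\<close> makes the denominator visibly
    positive.\<close>
  define \<rho> where "\<rho> = r / (real k + 1)"
  have \<rho>: "0 < \<rho>" "real k * \<rho> \<le> r" using c(2) by (auto simp: \<rho>_def field_simps)
  have in_A: "g (p y) \<in> A" if "y \<in> box q \<rho>" for y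
  proof -
    have "norm (p y - q) \<le> (\<Sum>b\<in>B. \<bar>p y \<bullet> b - q \<bullet> b\<bar>)"
      using norm_diff_le_sum_orthonormal[OF orth finB p_span q(1)] .
    also have "\<dots> \<le> (\<Sum>b\<in>B. \<rho>)"
      using that by (intro sum_mono) (simp add: mem_box p_inner)
    also have "\<dots> \<le> r" using \<rho>(2) B(2) by simp
    finally have "dist c (g (p y)) \<le> r"
      using gdist[OF p_span q(1)] q(2) by (simp add: dist_norm norm_minus_commute)
    moreover have "g (p y) \<in> S" using p_span g(2) by blast
    ultimately show ?thesis using A by auto
  qed
  \<comment> \<open>Chosen so that \<open>2 ^ k * e\<close> is the volume of
    \<open>box q \<rho>\<close>. The factor \<open>2 ^ k\<close> is the price of replacing a set of
    diameter \<open>d\<close> by a box of side \<open>2 * d\<close>.\<close>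
  define e where "e = (2 * \<rho>) ^ k / 2 ^ k"
  have "0 < ennreal e" using \<rho>(1) by (simp add: e_def)
  then obtain U where U: "A \<subseteq> (\<Union>i. U i)" "\<And>i. bounded (U i)" "\<And>i. diameter (U i) \<le> 1"
      "(\<Sum>i. diameter_power s (U i)) < ennreal e"
    using null unfolding hausdorff_measure_eq_0_iff by (metis zero_less_one)
  \<comment> \<open>The covering sets are arbitrary, so their preimages may fail to be measurable;
    each is enclosed in a measurable set, a box unless it is empty.\<close>
  have "\<exists>C. C \<in> sets lborel \<and> emeasure lborel C \<le> ennreal (2 ^ k) * diameter_power s (U i) \<and>
      {y \<in> box q \<rho>. g (p y) \<in> U i} \<subseteq> C" for i
  proof (cases "{y \<in> box q \<rho>. g (p y) \<in> U i} = {}")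
    case True
    then show ?thesis by (intro exI[of _ "{}"]) auto
  next
    case False
    then obtain x where x: "x \<in> box q \<rho>" "g (p x) \<in> U i" by blast
    define d where "d = diameter (U i)"
    have d: "0 \<le> d" "d \<le> 1" using U(2,3) diameter_ge_0 by (auto simp: d_def)
    have "{y \<in> box q \<rho>. g (p y) \<in> U i} \<subseteq> box x d"
    proof
      fix y assume y: "y \<in> {y \<in> box q \<rho>. g (p y) \<in> U i}"
      have "\<bar>y \<bullet> b - x \<bullet> b\<bar> \<le> d" if "b \<in> B" for b
      proof -
        have "\<bar>y \<bullet> b - x \<bullet> b\<bar> = \<bar>(p y - p x) \<bullet> b\<bar>"
          using that by (simp add: inner_diff_left p_inner)
        also have "\<dots> \<le> norm (p y - p x)"
          using Cauchy_Schwarz_ineq2[of "p y - p x" b] orth(2)[OF that] by simp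
        also have "\<dots> = dist (g (p y)) (g (p x))"
          using gdist[OF p_span p_span] by (simp add: dist_norm)
        also have "\<dots> \<le> d"
          unfolding d_def using diameter_bounded_bound[OF U(2)] x y by auto
        finally show ?thesis .
      qed
      then show "y \<in> box x d" using y by (auto simp: mem_box)
    qed
    moreover have "emeasure lborel (box x d) \<le> ennreal (2 ^ k) * diameter_power s (U i)"
    proof -
      have "ennreal (d ^ k) \<le> diameter_power s (U i)"
      \<comment> \<open>Covers of mesh 1 were taken so that \<open>d \<le> 1\<close>, which gives
        \<open>d ^ k \<le> d powr s\<close> for \<open>s < k\<close>. At \<open>d = 0\<close> the
        left side vanishes because \<open>k > 0\<close>; at \<open>s = 0\<close> the right side is 1
        because \<open>U i\<close> is nonempty.\<close>
      proof (cases "d = 0 \<or> s = 0")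
        case True
        then show ?thesis using x(2) d s
          by (auto simp: diameter_power_def k_def power_le_one zero_power)
      next
        case False
        then have "d ^ k = d powr real k" using d by (simp add: powr_realpow)
        also have "\<dots> \<le> d powr s" using d s False by (intro powr_mono') (auto simp: k_def)
        finally show ?thesis using False x(2)
          by (auto simp: diameter_power_def d_def[symmetric] intro!: ennreal_leI)
      qed
      then show ?thesis
        using d by (simp add: vol power_mult_distrib ennreal_mult mult_left_mono)
    qed
    ultimately show ?thesis using box_sets by blast
  qed
  then obtain C where C: "\<And>i. C i \<in> sets lborel"
      "\<And>i. emeasure lborel (C i) \<le> ennreal (2 ^ k) * diameter_power s (U i)"
      "\<And>i. {y \<in> box q \<rho>. g (p y) \<in> U i} \<subseteq> C i"
    by metis
  have "box q \<rho> \<subseteq> (\<Union>i. C i)"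
  proof
    fix y assume y: "y \<in> box q \<rho>"
    then obtain i where "g (p y) \<in> U i" using in_A U(1) by blast
    then show "y \<in> (\<Union>i. C i)" using C(3)[of i] y by blast
  qed
  then have "ennreal ((2 * \<rho>) ^ k) \<le> emeasure lborel (\<Union>i. C i)"
    using C(1) \<rho>(1) by (subst vol[symmetric, of \<rho> q]) (auto intro!: emeasure_mono)
  also have "\<dots> \<le> (\<Sum>i. emeasure lborel (C i))"
    using C(1) by (intro emeasure_subadditive_countably) auto
  also have "\<dots> \<le> (\<Sum>i. ennreal (2 ^ k) * diameter_power s (U i))"
    using C(2) by (intro suminf_le) auto
  also have "\<dots> = ennreal (2 ^ k) * (\<Sum>i. diameter_power s (U i))"
    by (rule ennreal_suminf_cmult)
  also have "\<dots> < ennreal (2 ^ k) * ennreal e"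
    using U(4) by (intro ennreal_mult_strict_left_mono) (auto simp: ennreal_zero_less_mult_iff)
  also have "\<dots> = ennreal ((2 * \<rho>) ^ k)"
    using \<rho>(1) by (simp add: e_def flip: ennreal_mult)
  finally show False by simp
qed

section \<open>Faces in a direction\<close>

text \<open>The real form of \<open>K \<inter> support_plane K u\<close>, written by comparison
  within \<open>K\<close> instead of a supremum, so that it makes sense without compactness.\<close>

definition max_face :: "'a::real_inner set \<Rightarrow> 'a \<Rightarrow> 'a set" where
  "max_face K u = {x \<in> K. \<forall>y\<in>K. y \<bullet> u \<le> x \<bullet> u}"

lemma max_face_nonempty:
  assumes "compact K" "K \<noteq> {}"
  shows "max_face K u \<noteq> {}"
proof -
  have "continuous_on K (\<lambda>x. x \<bullet> u)" by (intro continuous_intros)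
  from continuous_attains_sup[OF assms this] show ?thesis by (auto simp: max_face_def)
qed

lemma max_face_face_of:
  assumes "convex K"
  shows "max_face K u face_of K"
proof (cases "max_face K u = {}")
  case False
  then obtain x where x: "x \<in> max_face K u" by blast
  then have "max_face K u = K \<inter> {y. u \<bullet> y = u \<bullet> x}"
    by (auto simp: max_face_def inner_commute[of u] intro: antisym)
  moreover have "\<dots> face_of K"
    using x by (intro face_of_Int_supporting_hyperplane_le assms) (auto simp: max_face_def inner_commute[of u])
  ultimately show ?thesis by simp
qed simp

text \<open>Exchanging one summand of a maximal sum for a competitor cannot raise the value, so
  every summand is maximal; conversely the inequalities for the summands add up.\<close>

lemma max_face_sum:
  fixes K :: "'l::finite \<Rightarrow> 'a::real_inner set"
  shows "max_face (\<Sum>l\<in>UNIV. K l) u = (\<Sum>l\<in>UNIV. max_face (K l) u)"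
proof (intro equalityI subsetI)
  fix x assume x: "x \<in> max_face (\<Sum>l\<in>UNIV. K l) u"
  then obtain t where t: "\<And>l. t l \<in> K l" "x = sum t UNIV"
    by (auto simp: max_face_def set_sum_alt)
  have "t l \<in> max_face (K l) u" for l
    unfolding max_face_def
  proof (clarify, intro conjI ballI)
    fix y assume y: "y \<in> K l"
    have "sum (t(l := y)) UNIV \<in> (\<Sum>l\<in>UNIV. K l)"
      using t(1) y by (subst set_sum_alt) auto
    then have "sum (t(l := y)) UNIV \<bullet> u \<le> x \<bullet> u" using x by (auto simp: max_face_def)
    moreover have "sum (t(l := y)) UNIV = y + sum t (UNIV - {l})"
      by (subst sum.remove[of _ l]) (auto intro!: sum.cong)
    moreover have "x = t l + sum t (UNIV - {l})"
      unfolding t(2) by (rule sum.remove) auto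
    ultimately show "y \<bullet> u \<le> t l \<bullet> u" by (simp add: inner_add_left)
  qed (rule t(1))
  then show "x \<in> (\<Sum>l\<in>UNIV. max_face (K l) u)"
    unfolding t(2) by (subst set_sum_alt) auto
next
  fix x assume "x \<in> (\<Sum>l\<in>UNIV. max_face (K l) u)"
  then obtain t where t: "\<And>l. t l \<in> max_face (K l) u" "x = sum t UNIV"
    by (auto simp: set_sum_alt)
  have "y \<bullet> u \<le> x \<bullet> u" if y: "y \<in> (\<Sum>l\<in>UNIV. K l)" for y
  proof -
    obtain t' where t': "\<And>l. t' l \<in> K l" "y = sum t' UNIV"
      using y by (auto simp: set_sum_alt)
    show ?thesis
      unfolding t(2) t'(2) inner_sum_left using t(1) t'(1)
      by (intro sum_mono) (auto simp: max_face_def)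
  qed
  moreover have "x \<in> (\<Sum>l\<in>UNIV. K l)"
    using t by (subst set_sum_alt) (auto simp: max_face_def)
  ultimately show "x \<in> max_face (\<Sum>l\<in>UNIV. K l) u" by (simp add: max_face_def)
qed

text \<open>The exchange argument again, for sets \<open>D l\<close> not known to be faces in any
  direction; points \<open>t l\<close> of the nonempty sum fill the other slots. This carries
  information about the sum back to its individual summands.\<close>

lemma sum_subset_max_face_sumD:
  fixes K D :: "'l::finite \<Rightarrow> 'a::real_inner set"
  assumes D: "\<And>l. D l \<subseteq> K l" "(\<Sum>l\<in>UNIV. D l) \<noteq> {}"
    and sub: "(\<Sum>l\<in>UNIV. D l) \<subseteq> max_face (\<Sum>l\<in>UNIV. K l) u"
  shows "D l \<subseteq> max_face (K l) u"
proof
  fix d assume d: "d \<in> D l"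
  obtain t where t: "\<And>l. t l \<in> D l" using D(2) by (auto simp: set_sum_alt)
  have tK: "t l \<in> K l" for l using t D(1) by blast
  have s: "sum (t(l := z)) UNIV = z + sum t (UNIV - {l})" for z
    by (subst sum.remove[of _ l]) (auto intro!: sum.cong)
  have "sum (t(l := d)) UNIV \<in> (\<Sum>l\<in>UNIV. D l)"
    using t d by (subst set_sum_alt) auto
  then have m: "sum (t(l := d)) UNIV \<in> max_face (\<Sum>l\<in>UNIV. K l) u" using sub by blast
  have "y \<bullet> u \<le> d \<bullet> u" if "y \<in> K l" for y
  proof -
    have "sum (t(l := y)) UNIV \<in> (\<Sum>l\<in>UNIV. K l)"
      using tK that by (subst set_sum_alt) auto
    then have "sum (t(l := y)) UNIV \<bullet> u \<le> sum (t(l := d)) UNIV \<bullet> u"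
      using m by (simp only: max_face_def mem_Collect_eq)
    then show ?thesis unfolding s by (simp add: inner_add_left)
  qed
  then show "d \<in> max_face (K l) u" using d D(1) by (auto simp: max_face_def)
qed

section \<open>Normal spaces of faces and stability of a face under perturbation of its
  normal\<close>

definition orth_space :: "'a::real_inner set \<Rightarrow> 'a set \<Rightarrow> 'a set" where
  "orth_space E \<Delta> = {u \<in> E. \<forall>x\<in>\<Delta>. \<forall>y\<in>\<Delta>. (x - y) \<bullet> u = 0}"

lemma subspace_orth_space: "subspace E \<Longrightarrow> subspace (orth_space E \<Delta>)"
  unfolding orth_space_def subspace_def by (simp add: inner_add_right)

text \<open>Translating by a point of \<open>\<Delta>\<close> turns \<open>aff_dim\<close> into a
  linear dimension, and \<open>orth_space\<close> is the orthogonal complement, within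
  \<open>E\<close>, of the span of the translate.\<close>

lemma dim_orth_space:
  fixes E :: "'a::euclidean_space set"
  assumes E: "subspace E" "\<Delta> \<subseteq> E" and "\<Delta> \<noteq> {}"
  shows "int (dim (orth_space E \<Delta>)) = int (dim E) - aff_dim \<Delta>"
proof -
  obtain a where a: "a \<in> \<Delta>" using assms(3) by blast
  define T where "T = (+) (- a) ` \<Delta>"
  have "T \<subseteq> E" unfolding T_def using E a by (auto simp: subspace_def subset_iff subspace_diff)
  then have sub: "span T \<subseteq> E" by (simp add: E(1) span_minimal)
  have "aff_dim \<Delta> = int (dim T)"
    unfolding T_def using a by (intro aff_dim_eq_dim hull_inc)
  moreover have "dim {y \<in> E. \<forall>x\<in>span T. orthogonal x y} + dim (span T) = dim E"
    by (rule dim_subspace_orthogonal_to_vectors[OF subspace_span E(1) sub])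
  moreover have "{y \<in> E. \<forall>x\<in>span T. orthogonal x y} = orth_space E \<Delta>"
  proof (intro equalityI subsetI)
    fix u assume u: "u \<in> {y \<in> E. \<forall>x\<in>span T. orthogonal x y}"
    have "(x - y) \<bullet> u = 0" if "x \<in> \<Delta>" "y \<in> \<Delta>" for x y
    proof -
      have "(- a + x) - (- a + y) \<in> span T"
        using that by (intro span_diff span_base) (auto simp: T_def)
      then show ?thesis using u by (auto simp: orthogonal_def)
    qed
    then show "u \<in> orth_space E \<Delta>" using u by (auto simp: orth_space_def)
  next
    fix u assume u: "u \<in> orth_space E \<Delta>"
    have "orthogonal u x" if "x \<in> span T" for x
    proof (rule orthogonal_to_span[OF that])
      fix z assume "z \<in> T"
      then show "orthogonal u z" using u a
        by (auto simp: T_def orth_space_def orthogonal_def inner_commute[of u])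
    qed
    then show "u \<in> {y \<in> E. \<forall>x\<in>span T. orthogonal x y}"
      using u by (auto simp: orth_space_def orthogonal_commute)
  qed
  ultimately show ?thesis by (simp add: dim_span)
qed

lemma mem_orth_space_max_face:
  assumes "u \<in> E"
  shows "u \<in> orth_space E (max_face K u)"
proof -
  have "(x - y) \<bullet> u = 0" if "x \<in> max_face K u" "y \<in> max_face K u" for x y
    using that unfolding inner_diff_left eq_iff_diff_eq_0[symmetric]
    by (intro antisym) (simp_all add: max_face_def)
  then show ?thesis using assms unfolding orth_space_def by blast
qed

text \<open>Only finitely many vertices compete with the face, so a small perturbation of its outer normal
  that stays orthogonal to the face still attains its maximum there.\<close>

lemma max_face_convex_hull_stable:
  fixes V :: "'a::euclidean_space set"
  assumes V: "finite V" and ne: "max_face (convex hull V) u \<noteq> {}"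
  obtains r where "0 < r"
    "\<And>w. w \<in> orth_space E (max_face (convex hull V) u) \<Longrightarrow> dist u w \<le> r \<Longrightarrow>
       max_face (convex hull V) u \<subseteq> max_face (convex hull V) w"
proof -
  define K where "K = convex hull V"
  obtain x where x: "x \<in> max_face K u" using ne by (auto simp: K_def)
  \<comment> \<open>These generators lie strictly below the maximum in direction \<open>u\<close>,
    and a strict inequality survives a small change of direction.\<close>
  define W where "W = V - max_face K u"
  have "\<exists>r>0. \<forall>w. dist u w < r \<longrightarrow> v \<bullet> w < x \<bullet> w" if v: "v \<in> W" for v
  proof -
    have "v \<in> K" using v by (auto simp: W_def K_def hull_inc)
    have "v \<bullet> u < x \<bullet> u"
    proof (rule ccontr)
      assume "\<not> v \<bullet> u < x \<bullet> u"
      then have "v \<in> max_face K u" using x \<open>v \<in> K\<close> by (force simp: max_face_def)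
      then show False using v by (simp add: W_def)
    qed
    moreover have "open {w. v \<bullet> w < x \<bullet> w}" by (intro open_Collect_less continuous_intros)
    ultimately show ?thesis
      unfolding open_contains_ball by (auto simp: subset_iff)
  qed
  then obtain \<rho> where \<rho>: "\<And>v. v \<in> W \<Longrightarrow> 0 < \<rho> v" "\<And>v w. v \<in> W \<Longrightarrow> dist u w < \<rho> v \<Longrightarrow> v \<bullet> w < x \<bullet> w"
    by metis
  have finW: "finite W" using V by (simp add: W_def)
  \<comment> \<open>The 1 covers the case of empty \<open>W\<close>; halving puts \<open>r\<close>
    strictly below every \<open>\<rho> v\<close>, so a closed ball can be used.\<close>
  define r where "r = Min (insert 1 (\<rho> ` W)) / 2"
  have M: "0 < Min (insert 1 (\<rho> ` W))" using finW \<rho>(1) by simp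
  have r: "0 < r" "\<And>v. v \<in> W \<Longrightarrow> r < \<rho> v"
  proof -
    show "0 < r" using M by (simp add: r_def)
    fix v assume "v \<in> W"
    then have "Min (insert 1 (\<rho> ` W)) \<le> \<rho> v" using finW by (intro Min_le) auto
    then show "r < \<rho> v" using M by (simp add: r_def)
  qed
  have "max_face K u \<subseteq> max_face K w" if w: "w \<in> orth_space E (max_face K u)" "dist u w \<le> r" for w
  proof
    fix y assume y: "y \<in> max_face K u"
    have yx: "z \<bullet> w = x \<bullet> w" if "z \<in> max_face K u" for z
    proof -
      have "(z - x) \<bullet> w = 0" using w(1) x that by (simp add: orth_space_def)
      then show ?thesis by (simp add: inner_diff_left)
    qed
    have "v \<bullet> w \<le> x \<bullet> w" if "v \<in> V" for v
    proof (cases "v \<in> W")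
      case True
      then show ?thesis using \<rho>(2) r(2) w(2) by (meson le_less_trans less_imp_le)
    next
      case False
      then show ?thesis using yx that by (simp add: W_def)
    qed
    then have "V \<subseteq> {z. w \<bullet> z \<le> x \<bullet> w}" by (auto simp: inner_commute)
    then have "K \<subseteq> {z. w \<bullet> z \<le> x \<bullet> w}"
      unfolding K_def by (rule hull_minimal) (rule convex_halfspace_le)
    then show "y \<in> max_face K w"
      using y yx[OF y] by (auto simp: max_face_def inner_commute)
  qed
  then show ?thesis using that r(1) by (auto simp: K_def)
qed

text \<open>Faces of a polytope are exposed, but the exposing normal may leave \<open>E\<close>. Its
  component orthogonal to \<open>E\<close> vanishes on \<open>K\<close> and is dropped.\<close>

lemma face_of_polytope_max_face:
  fixes K :: "'a::euclidean_space set"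
  assumes K: "polytope K" and E: "subspace E" "K \<subseteq> E" and \<Delta>: "\<Delta> face_of K" "\<Delta> \<noteq> {}"
  obtains u where "u \<in> E" "\<Delta> = max_face K u"
proof -
  have "\<Delta> exposed_face_of K"
    using K \<Delta>(1) by (simp add: exposed_face_of_polyhedron polytope_imp_polyhedron)
  then obtain a b where ab: "K \<subseteq> {x. a \<bullet> x \<le> b}" "\<Delta> = K \<inter> {x. a \<bullet> x = b}"
    by (auto simp: exposed_face_of_def)
  obtain u w where uw: "u \<in> span E" "\<And>z. z \<in> span E \<Longrightarrow> orthogonal w z" "a = u + w"
    using orthogonal_subspace_decomp_exists[of E a] by metis
  have spE: "span E = E" using E(1) by (simp add: span_eq_iff)
  have "x \<bullet> u = a \<bullet> x" if "x \<in> K" for x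
    using uw(2)[of x] uw(3) that E(2) spE
    by (auto simp: orthogonal_def inner_add_left inner_commute[of x])
  moreover obtain x where "x \<in> K" "a \<bullet> x = b" using \<Delta>(2) ab(2) by blast
  ultimately have "\<Delta> = max_face K u"
    unfolding ab(2) max_face_def using ab(1) by (auto intro: antisym)
  then show ?thesis using that uw(1) spE by auto
qed

section \<open>Newton polytopes\<close>

lemma Re_herm_eq_inner: "Re (herm z w) = z \<bullet> w"
  by (simp add: herm_def inner_vec_def inner_complex_def)

lemma subspace_imag_space: "subspace (imag_space :: (complex ^ 'n) set)"
  by (simp add: imag_space_def subspace_def)

lemma dim_imag_space: "dim (imag_space :: (complex ^ 'n) set) = CARD('n)"
proof -
  define j where "j = (\<lambda>x :: real ^ 'n. (\<chi> i. Complex 0 (x $ i)) :: complex ^ 'n)"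
  have lin: "linear j"
    by (rule linearI) (auto simp: j_def vec_eq_iff complex_eq_iff)
  have "inj j" by (auto simp: inj_def j_def vec_eq_iff)
  moreover have "range j = imag_space"
  proof -
    have "z = j (\<chi> i. Im (z $ i))" if "z \<in> imag_space" for z
      using that by (auto simp: j_def imag_space_def vec_eq_iff complex_eq_iff)
    then show ?thesis by (fastforce simp: imag_space_def j_def[THEN fun_cong])
  qed
  ultimately show ?thesis
    using dim_image_eq[OF lin, of UNIV] by (simp add: dim_UNIV)
qed

text \<open>Compactness makes the supremum in \<open>support_fun\<close> an attained value;
  \<open>K \<subseteq> imag_space\<close> matches the restriction built into
  \<open>support_plane\<close>.\<close>

lemma Int_support_plane_eq_max_face:
  assumes K: "compact K" "K \<subseteq> imag_space" "K \<noteq> {}"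
  shows "K \<inter> support_plane K u = max_face K u"
proof -
  obtain x where x: "x \<in> max_face K u" using max_face_nonempty[OF K(1,3)] by blast
  then have "support_fun K u = x \<bullet> u"
    unfolding support_fun_def Re_herm_eq_inner
    by (intro cSup_eq_maximum) (auto simp: max_face_def inner_commute)
  then show ?thesis
    using x K(2) by (force simp: support_plane_def Re_herm_eq_inner max_face_def intro: antisym)
qed

lemma rotated_spectrum:
  assumes "exp_sum f"
  shows "finite (rotated_spectrum f)" "rotated_spectrum f \<noteq> {}" "rotated_spectrum f \<subseteq> imag_space"
  using exp_sum_rep_exp_coeff[OF assms]
  by (auto simp: exp_sum_rep_def rotated_spectrum_def spectrum_def imag_space_def cvec_def)

lemma newton_polytope:
  assumes "exp_sum f"
  shows "polytope (newton_polytope f)" "newton_polytope f \<noteq> {}" "newton_polytope f \<subseteq> imag_space"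
proof -
  show "polytope (newton_polytope f)" "newton_polytope f \<noteq> {}"
    using rotated_spectrum[OF assms] by (auto simp: newton_polytope_def polytope_convex_hull)
  show "newton_polytope f \<subseteq> imag_space"
    unfolding newton_polytope_def using rotated_spectrum(3)[OF assms] subspace_imag_space
    by (intro hull_minimal subspace_imp_convex)
qed

text \<open>A unique maximiser is an extreme point, hence one of the generators of the hull. Were it
  interior relative to \<open>imag_space\<close>, a short move that does not lower the value would
  produce a second maximiser.\<close>

lemma max_face_singleton_boundary_spectrum:
  fixes f :: "complex ^ 'n \<Rightarrow> complex"
  assumes f: "exp_sum f" and u: "u \<in> imag_space" and v: "max_face (newton_polytope f) u = {v}"
  shows "v \<in> boundary_spectrum f"
proof -
  let ?K = "newton_polytope f"
  have conv: "convex ?K" by (simp add: newton_polytope_def)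
  have vK: "v \<in> ?K" using v by (auto simp: max_face_def)
  have vE: "v \<in> imag_space" using vK newton_polytope(3)[OF f] by blast
  have "{v} face_of ?K" using max_face_face_of[OF conv, of u] v by simp
  then have "v \<in> rotated_spectrum f"
    unfolding newton_polytope_def face_of_singleton by (rule extreme_point_of_convex_hull)
  moreover have "v \<notin> top_of_set imag_space interior_of ?K"
  proof
    assume "v \<in> top_of_set imag_space interior_of ?K"
    then obtain T where T: "openin (top_of_set imag_space) T" "v \<in> T" "T \<subseteq> ?K"
      by (auto simp: interior_of_def)
    then obtain e where e: "0 < e" "ball v e \<inter> imag_space \<subseteq> T"
      unfolding openin_contains_ball by blast
    \<comment> \<open>For \<open>u = 0\<close> any nonzero direction keeps the value, and one exists
      as the dimension is positive; otherwise \<open>u\<close> itself serves.\<close>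
    obtain w :: "complex ^ 'n" where w: "w \<in> imag_space" "w \<noteq> 0" "0 \<le> w \<bullet> u"
    proof (cases "u = 0")
      case True
      have "0 < dim (imag_space :: (complex ^ 'n) set)" by (simp add: dim_imag_space)
      then have "\<not> (imag_space :: (complex ^ 'n) set) \<subseteq> {0}" by (metis dim_eq_0 less_irrefl)
      then show ?thesis using that True by auto
    next
      case False
      then show ?thesis using that[of u] u by simp
    qed
    define x where "x = v + (e / (2 * norm w)) *\<^sub>R w"
    have xv: "x - v = (e / (2 * norm w)) *\<^sub>R w" by (simp add: x_def)
    have "norm (x - v) = e / 2" using w(2) e(1) by (simp add: xv)
    then have "x \<in> ball v e" using e(1) by (simp add: dist_norm norm_minus_commute)
    moreover have "x \<in> imag_space"
      unfolding x_def using vE w(1) subspace_imag_space by (intro subspace_add subspace_scale)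
    ultimately have xK: "x \<in> ?K" using e T(3) by auto
    have "v \<bullet> u \<le> x \<bullet> u" using w(3) e(1) by (simp add: x_def inner_add_left)
    moreover have "y \<bullet> u \<le> v \<bullet> u" if "y \<in> ?K" for y
      using v that by (auto simp: max_face_def)
    ultimately have "x \<in> max_face ?K u"
      using xK by (auto simp: max_face_def intro: order_trans)
    then have "x = v" using v by simp
    then show False using e(1) w(2) by (simp add: x_def)
  qed
  then have "v \<in> top_of_set imag_space frontier_of ?K"
    using vK vE by (auto simp: frontier_of_def in_closure_of)
  ultimately show ?thesis by (simp add: boundary_spectrum_def)
qed

text \<open>Every unique maximiser belongs to \<open>boundary_spectrum f\<close>, so the union of
  dual cones misses no direction that has one.\<close>

lemma exceptional_set_eq:
  assumes f: "exp_sum f"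
  shows "exceptional_set f = {u \<in> imag_space. \<nexists>v. max_face (newton_polytope f) u = {v}}"
proof -
  have "newton_polytope f \<inter> support_plane (newton_polytope f) u = max_face (newton_polytope f) u" for u
    using newton_polytope[OF f] by (intro Int_support_plane_eq_max_face polytope_imp_compact)
  then have "dual_cone v (newton_polytope f) = {u \<in> imag_space. max_face (newton_polytope f) u = {v}}" for v
    by (auto simp: dual_cone_def)
  then show ?thesis
    unfolding exceptional_set_def using max_face_singleton_boundary_spectrum[OF f] by auto
qed

text \<open>Convex hulls commute with Minkowski sums, so the sum of the finite spectra is a finite
  generating set, as the stability of faces requires.\<close>

lemma newton_polytope_sum:
  assumes "F \<in> Exp_maps"
  obtains V where "finite V" "newton_polytope_sum F = convex hull V"
    "newton_polytope_sum F \<subseteq> imag_space" "newton_polytope_sum F \<noteq> {}"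
proof
  have ex: "exp_sum (component F l)" for l using assms by (simp add: Exp_maps_def)
  show "finite (\<Sum>l\<in>UNIV. rotated_spectrum (component F l))"
    using rotated_spectrum(1)[OF ex] by (intro finite_set_sum) auto
  show "newton_polytope_sum F = convex hull (\<Sum>l\<in>UNIV. rotated_spectrum (component F l))"
    by (simp add: newton_polytope_sum_def newton_polytope_def convex_hull_set_sum)
  show "newton_polytope_sum F \<subseteq> imag_space"
    unfolding newton_polytope_sum_def using newton_polytope(3)[OF ex] subspace_imag_space
    by (subst set_sum_alt) (auto intro!: subspace_sum)
  show "newton_polytope_sum F \<noteq> {}"
  proof -
    have "\<exists>s. \<forall>l. s l \<in> newton_polytope (component F l)"
      using newton_polytope(2)[OF ex] by (intro choice) (simp add: ex_in_conv)
    then show ?thesis by (simp add: newton_polytope_sum_def set_sum_alt)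
  qed
qed

theorem lemma6p4:
  fixes F :: "complex ^ 'n \<Rightarrow> complex ^ 'm"
  assumes "F \<in> Exp_maps"
    and "1 \<le> CARD('m)" and "CARD('m) \<le> CARD('n)"
  shows "closed_spectra F \<longleftrightarrow>
           hausdorff_dim (exceptional_set_map F) \<le> of_nat (CARD('n) - CARD('m))"
proof -
  let ?E = "imag_space :: (complex ^ 'n) set"
  define K where "K = (\<lambda>l. newton_polytope (component F l))"
  define P where "P = newton_polytope_sum F"
  have P_sum: "P = (\<Sum>l\<in>UNIV. K l)" by (simp add: P_def K_def newton_polytope_sum_def)
  have ex: "exp_sum (component F l)" for l using assms(1) by (simp add: Exp_maps_def)
  have K: "compact (K l)" "convex (K l)" "K l \<noteq> {}" for l
    using newton_polytope[OF ex[of l]] polytope_imp_compact polytope_imp_convex by (auto simp: K_def)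
  obtain V where V: "finite V" "P = convex hull V" and PE: "P \<subseteq> ?E" "P \<noteq> {}"
    using newton_polytope_sum[OF assms(1)] by (metis P_def)
  have P: "polytope P" "convex P" "compact P"
    using V by (auto simp: polytope_convex_hull finite_imp_compact_convex_hull)
  have Z: "exceptional_set_map F = {u \<in> ?E. \<forall>l. \<nexists>v. max_face (K l) u = {v}}"
    by (auto simp: exceptional_set_map_def exceptional_set_eq[OF ex] K_def)
  have dim: "int (dim (orth_space ?E \<Delta>)) = int CARD('n) - aff_dim \<Delta>"
    if "\<Delta> \<subseteq> P" "\<Delta> \<noteq> {}" for \<Delta>
    using dim_orth_space[OF subspace_imag_space, of \<Delta>] that PE(1) by (simp add: dim_imag_space)
  have closed_iff: "closed_spectra F \<longleftrightarrow> (\<forall>\<Delta> D. \<Delta> face_of P \<longrightarrow> \<Delta> \<noteq> {} \<longrightarrow>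
      (\<forall>l. D l face_of K l) \<longrightarrow> \<Delta> = (\<Sum>l\<in>UNIV. D l) \<longrightarrow> aff_dim \<Delta> < int CARD('m) \<longrightarrow>
      (\<exists>l v. D l = {v}))"
    by (simp only: closed_spectra_def P_def K_def)
  show ?thesis
  proof
    assume closed: "closed_spectra F"
    have point: "\<exists>l v. D l = {v}"
      if "\<Delta> face_of P" "\<Delta> \<noteq> {}" "\<And>l. D l face_of K l" "\<Delta> = (\<Sum>l\<in>UNIV. D l)"
        "aff_dim \<Delta> < int CARD('m)" for \<Delta> D
      using closed that unfolding closed_iff by blast
    let ?\<A> = "orth_space ?E ` {\<Delta>. \<Delta> face_of P \<and> \<Delta> \<noteq> {} \<and> int CARD('m) \<le> aff_dim \<Delta>}"
    have sub: "exceptional_set_map F \<subseteq> \<Union>?\<A>"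
    proof
      fix u assume "u \<in> exceptional_set_map F"
      then have u: "u \<in> ?E" "\<And>l. \<nexists>v. max_face (K l) u = {v}" by (auto simp: Z)
      have "max_face P u face_of P" "max_face P u \<noteq> {}"
        using max_face_face_of[OF P(2)] max_face_nonempty[OF P(3) PE(2)] by auto
      \<comment> \<open>The faces \<open>max_face (K l) u\<close> decompose
        \<open>max_face P u\<close>; a smaller dimension would force one of them to be a
        point.\<close>
      moreover have "int CARD('m) \<le> aff_dim (max_face P u)"
      proof (rule ccontr)
        assume "\<not> int CARD('m) \<le> aff_dim (max_face P u)"
        then have "\<exists>l v. max_face (K l) u = {v}"
          using \<open>max_face P u face_of P\<close> \<open>max_face P u \<noteq> {}\<close> max_face_face_of[OF K(2)]
          by (intro point[of "max_face P u"]) (auto simp: P_sum max_face_sum)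
        then show False using u(2) by blast
      qed
      ultimately show "u \<in> \<Union>?\<A>" using mem_orth_space_max_face[OF u(1), of P] by blast
    qed
    have fin: "finite ?\<A>"
      using finite_polytope_faces[OF P(1)] by (auto intro: finite_subset)
    have "hausdorff_measure s (exceptional_set_map F) = 0" if "real (CARD('n) - CARD('m)) < s" for s
    proof (rule hausdorff_measure_0_mono[OF hausdorff_measure_0_Union_finite[OF fin] sub])
      fix A assume "A \<in> ?\<A>"
      then obtain \<Delta> where \<Delta>: "\<Delta> face_of P" "\<Delta> \<noteq> {}" "int CARD('m) \<le> aff_dim \<Delta>"
        "A = orth_space ?E \<Delta>" by blast
      have "dim A \<le> CARD('n) - CARD('m)"
        unfolding \<Delta>(4) using dim[OF face_of_imp_subset[OF \<Delta>(1)] \<Delta>(2)] \<Delta>(3) assms(3)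
        by linarith
      then show "hausdorff_measure s A = 0"
        using that \<Delta>(4) subspace_orth_space[OF subspace_imag_space]
        by (intro hausdorff_measure_subspace_0) auto
    qed
    then show "hausdorff_dim (exceptional_set_map F) \<le> of_nat (CARD('n) - CARD('m))"
      unfolding ennreal_of_nat_eq_real_of_nat by (intro hausdorff_dim_leI) auto
  next
    assume le: "hausdorff_dim (exceptional_set_map F) \<le> of_nat (CARD('n) - CARD('m))"
    show "closed_spectra F"
    proof (rule ccontr)
      assume "\<not> closed_spectra F"
      then obtain \<Delta> D where \<Delta>: "\<Delta> face_of P" "\<Delta> \<noteq> {}" "aff_dim \<Delta> < int CARD('m)"
        and D: "\<And>l. D l face_of K l" "\<Delta> = (\<Sum>l\<in>UNIV. D l)" "\<And>l. \<nexists>v. D l = {v}"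
        unfolding closed_iff not_all not_imp by blast
      obtain u where u: "u \<in> ?E" "\<Delta> = max_face P u"
        using face_of_polytope_max_face[OF P(1) subspace_imag_space PE(1) \<Delta>(1,2)] by blast
      define S where "S = orth_space ?E \<Delta>"
      have S: "subspace S" "u \<in> S"
        using subspace_orth_space[OF subspace_imag_space] mem_orth_space_max_face[OF u(1)] u(2)
        by (auto simp: S_def)
      \<comment> \<open>Since \<open>m \<le> n\<close>, the truncated subtraction is exact, and
        \<open>aff_dim \<Delta> < m\<close> becomes a strict gap.\<close>
      have dimS: "CARD('n) - CARD('m) < dim S"
        using dim[OF face_of_imp_subset[OF \<Delta>(1)] \<Delta>(2)] \<Delta>(3) assms(3) unfolding S_def by linarith
      obtain r where r: "0 < r" "\<And>w. w \<in> S \<Longrightarrow> dist u w \<le> r \<Longrightarrow> \<Delta> \<subseteq> max_face P w"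
        using max_face_convex_hull_stable[OF V(1), of u ?E] \<Delta>(2) u(2) V(2) unfolding S_def by metis
      have sub: "S \<inter> cball u r \<subseteq> exceptional_set_map F"
      proof
        fix w assume w: "w \<in> S \<inter> cball u r"
        then have Dw: "(\<Sum>l\<in>UNIV. D l) \<subseteq> max_face (\<Sum>l\<in>UNIV. K l) w"
          using r(2) D(2) by (simp add: P_sum)
        \<comment> \<open>\<open>D l\<close> is nonempty because \<open>\<Delta>\<close> is, and it
          is not a point, so no singleton can contain it.\<close>
        have "max_face (K l) w \<noteq> {v}" for l v
        proof
          assume "max_face (K l) w = {v}"
          moreover have "D l \<subseteq> max_face (K l) w"
            using sum_subset_max_face_sumD[OF face_of_imp_subset[OF D(1)] _ Dw] \<Delta>(2) D(2) by simp
          moreover have "D l \<noteq> {}"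
            using \<Delta>(2) D(2) by (auto simp: set_sum_alt)
          ultimately show False using D(3)[of l] by (auto simp: subset_singleton_iff)
        qed
        then show "w \<in> exceptional_set_map F"
          using w by (auto simp: Z S_def orth_space_def)
      qed
      have "of_nat (CARD('n) - CARD('m)) < ennreal (real (dim S))"
        using dimS by (simp add: ennreal_of_nat_eq_real_of_nat ennreal_less_iff)
      with le have "hausdorff_dim (exceptional_set_map F) < ennreal (real (dim S))"
        by (rule le_less_trans)
      then obtain s where "0 \<le> s" "s < real (dim S)" "hausdorff_measure s (exceptional_set_map F) = 0"
        by (rule hausdorff_dim_lessE)
      then show False
        using hausdorff_measure_neq_0[OF S(1) _ _ S(2) r(1) sub] by blast
    qed
  qed
qed

end
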